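(* Let $0<p<1$ and let $S_p$ be the transition operator of the stochastic Fibonacci adding machine, acting by $v\mapsto S_pv$ on complex sequences viewed as column vectors. Let $g:\mathbb{C}^2\to\mathbb{C}^2$ be defined by $$g(x,y)=\Big(\tfrac{1}{p^2}(x-1+p)(y-1+p),\,x\Big),$$ let $J(g)$ be the filled Julia set of $g$, and let $$\mathcal{E}_p=\{\lambda\in\mathbb{C} : (\lambda_1,\lambda)\in J(g)\},\qquad \lambda_1=1-p+\frac{(1-\lambda-p)^2}{p}.$$ Then for every $X\in\{\ell^\infty,\,c_0,\,c\}\cup\{\ell^\alpha : 1\le\alpha<\infty\}$, the spectrum of $S_p$ acting on $X$ contains $\mathcal{E}_p$.
   Context: $\mathbb{N}=\{0,1,2,\dots\}$. Let $F_0=1$, $F_1=2$, $F_n=F_{n-1}+F_{n-2}$ for $n\ge2$. Every $N\in\mathbb{N}$ is written uniquely as $N=\sum_{i\ge0}\varepsilon_i(N)F_i$ with $\varepsilon_i(N)\in\{0,1\}$, finitely many nonzero digits, and no two consecutive digits both equal to $1$ (Fibonacci representation, written $\dots\varepsilon_2\varepsilon_1\varepsilon_0$). The operator $S_p$ is given by the infinite matrix $((S_p)_{N,M})_{N,M\in\mathbb{N}}$ (the transition probability from $N$ to $M$) whose nonzero entries in row $N$ are the following: (1) $(S_p)_{N,N}=1-p$ for all $N$; (2) if $\varepsilon_0(N)=\varepsilon_1(N)=0$, then $(S_p)_{N,N+1}=p$; (3) if $N=\dots 00\underbrace{1010\cdots10}_{2s}$ with $s\ge1$ (i.e. $\varepsilon_{2i-1}(N)=1$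 for $1\le i\le s$ and $\varepsilon_{2s}(N)=\varepsilon_{2s+1}(N)=0$), then $(S_p)_{N,N+1}=p^{s+1}$ and, for $1\le m\le s$, $(S_p)_{N,\,N-F_{2m}+1}=p^m(1-p)$, where $F_{2m}-1=\sum_{i=1}^{m}F_{2i-1}$; (4) if $N=\dots 0\underbrace{0101\cdots01}_{2s}$ with $s\ge2$ (i.e. $\varepsilon_{2i}(N)=1$ for $0\le i\le s-1$ and $\varepsilon_{2s-1}(N)=\varepsilon_{2s}(N)=0$), then $(S_p)_{N,N+1}=p^{s}$ and, for $2\le m\le s$, $(S_p)_{N,\,N-F_{2m-1}+1}=p^{m-1}(1-p)$, where $F_{2m-1}-1=\sum_{i=0}^{m-1}F_{2i}$; (5) if $N=\dots001$ (i.e. $\varepsilon_0(N)=1$, $\varepsilon_1(N)=\varepsilon_2(N)=0$), then $(S_p)_{N,N+1}=p$. It acts by $(S_pv)_N=\sum_{M}(S_p)_{N,M}v_M$, and defines a bounded operator on each of the spaces below. $c_0$ is the space of complex sequences indexed by $\mathbb{N}$ converging to $0$, $c$ the space of convergent complex sequences, both with the sup norm; $\ell^\alpha=\ell^\alpha(\mathbb{N})$, $1\le\alpha\le\infty$, are the usual complex sequence spaces. The spectrum of a bounded operator $T$ is the set of $\lambda\in\mathbb{C}$ for which $T-\lambda\,\mathrm{Id}$ is not an isomorphism. The filled Julia set of $g$ is $J(g)=\{(x,y)\in\mathbb{C}^2 : (g^n(x,y))_{n\ge0}\text{ is bounded}\}$, with $g^n$ the $n$-th iterate of $g$. *)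

theory Defs
  imports "HOL-Analysis.Analysis"
begin

fun F :: "nat \<Rightarrow> nat" where
  "F 0 = 1"
| "F (Suc 0) = 2"
| "F (Suc (Suc n)) = F (Suc n) + F n"

definition fib_rep :: "(nat \<Rightarrow> nat) \<Rightarrow> nat \<Rightarrow> bool" where
  "fib_rep e N \<longleftrightarrow>
     (\<forall>i. e i \<in> {0, 1}) \<and> finite {i. e i \<noteq> 0} \<and>
     (\<forall>i. \<not> (e i = 1 \<and> e (Suc i) = 1)) \<and>
     N = (\<Sum>i | e i \<noteq> 0. e i * F i)"

text \<open>The representation exists and is unique, so the description is well defined.\<close>

definition digit :: "nat \<Rightarrow> nat \<Rightarrow> nat" where
  "digit i N = (THE e. fib_rep e N) i"

text \<open>
  The least significant digit has index 0. Digits that are not mentioned inside the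
  blocks \<open>1010...10\<close> and \<open>0101...01\<close> are 0, since no two consecutive digits are 1.
\<close>

definition ends_10 :: "nat \<Rightarrow> nat \<Rightarrow> bool" where
  "ends_10 s N \<longleftrightarrow>
     (\<forall>i\<in>{1..s}. digit (2 * i - 1) N = 1) \<and> digit (2 * s) N = 0 \<and> digit (2 * s + 1) N = 0"

definition ends_01 :: "nat \<Rightarrow> nat \<Rightarrow> bool" where
  "ends_01 s N \<longleftrightarrow>
     (\<forall>i<s. digit (2 * i) N = 1) \<and> digit (2 * s - 1) N = 0 \<and> digit (2 * s) N = 0"

text \<open>
  \<open>transition p N M r\<close>: the machine moves from \<open>N\<close> to \<open>M\<close> with probability \<open>r\<close>.
  The targets \<open>N + 1 - F j\<close> are never truncated, because there \<open>F j - 1\<close> is the value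
  of the lowest \<open>j\<close> digits of \<open>N\<close>. For given \<open>N\<close> and \<open>M\<close> at most one \<open>r\<close> is possible.
\<close>

inductive transition :: "real \<Rightarrow> nat \<Rightarrow> nat \<Rightarrow> real \<Rightarrow> bool" for p :: real where
  stay: "transition p N N (1 - p)"
| succ_00: "digit 0 N = 0 \<Longrightarrow> digit 1 N = 0 \<Longrightarrow> transition p N (N + 1) p"
| succ_10: "1 \<le> s \<Longrightarrow> ends_10 s N \<Longrightarrow> transition p N (N + 1) (p ^ (s + 1))"
| back_10: "1 \<le> s \<Longrightarrow> ends_10 s N \<Longrightarrow> 1 \<le> m \<Longrightarrow> m \<le> s \<Longrightarrow>
     transition p N (N + 1 - F (2 * m)) (p ^ m * (1 - p))"
| succ_01: "2 \<le> s \<Longrightarrow> ends_01 s N \<Longrightarrow> transition p N (N + 1) (p ^ s)"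
| back_01: "2 \<le> s \<Longrightarrow> ends_01 s N \<Longrightarrow> 2 \<le> m \<Longrightarrow> m \<le> s \<Longrightarrow>
     transition p N (N + 1 - F (2 * m - 1)) (p ^ (m - 1) * (1 - p))"
| succ_001: "digit 0 N = 1 \<Longrightarrow> digit 1 N = 0 \<Longrightarrow> digit 2 N = 0 \<Longrightarrow> transition p N (N + 1) p"

definition S_matrix :: "real \<Rightarrow> nat \<Rightarrow> nat \<Rightarrow> real" where
  "S_matrix p N M =
     (if \<exists>r. transition p N M r then THE r. transition p N M r else 0)"

text \<open>Every row has finitely many nonzero entries, so the series is a finite sum.\<close>

definition S :: "real \<Rightarrow> (nat \<Rightarrow> complex) \<Rightarrow> nat \<Rightarrow> complex" where
  "S p v = (\<lambda>N. \<Sum>M. complex_of_real (S_matrix p N M) * v M)"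

definition ell_infty :: "(nat \<Rightarrow> complex) set" where
  "ell_infty = {v. bounded (range v)}"

definition c_conv :: "(nat \<Rightarrow> complex) set" where
  "c_conv = {v. convergent v}"

definition c_zero :: "(nat \<Rightarrow> complex) set" where
  "c_zero = {v. v \<longlonglongrightarrow> 0}"

definition sup_norm :: "(nat \<Rightarrow> complex) \<Rightarrow> real" where
  "sup_norm v = (SUP n. cmod (v n))"

definition ell :: "real \<Rightarrow> (nat \<Rightarrow> complex) set" where
  "ell \<alpha> = {v. summable (\<lambda>n. cmod (v n) powr \<alpha>)}"

definition ell_norm :: "real \<Rightarrow> (nat \<Rightarrow> complex) \<Rightarrow> real" where
  "ell_norm \<alpha> v = (\<Sum>n. cmod (v n) powr \<alpha>) powr (1 / \<alpha>)"

text \<open>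
  A sequence space is given by its carrier \<open>X\<close> and its norm \<open>nrm\<close>; an isomorphism is a
  bounded linear bijection of \<open>X\<close> onto itself with bounded inverse.
\<close>

definition bounded_operator_on ::
  "(nat \<Rightarrow> complex) set \<Rightarrow> ((nat \<Rightarrow> complex) \<Rightarrow> real)
     \<Rightarrow> ((nat \<Rightarrow> complex) \<Rightarrow> nat \<Rightarrow> complex) \<Rightarrow> bool" where
  "bounded_operator_on X nrm T \<longleftrightarrow>
     T ` X \<subseteq> X \<and>
     (\<forall>u\<in>X. \<forall>v\<in>X. T (\<lambda>n. u n + v n) = (\<lambda>n. T u n + T v n)) \<and>
     (\<forall>a. \<forall>v\<in>X. T (\<lambda>n. a * v n) = (\<lambda>n. a * T v n)) \<and>
     (\<exists>C. \<forall>v\<in>X. nrm (T v) \<le> C * nrm v)"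

definition isomorphism_on ::
  "(nat \<Rightarrow> complex) set \<Rightarrow> ((nat \<Rightarrow> complex) \<Rightarrow> real)
     \<Rightarrow> ((nat \<Rightarrow> complex) \<Rightarrow> nat \<Rightarrow> complex) \<Rightarrow> bool" where
  "isomorphism_on X nrm T \<longleftrightarrow>
     bounded_operator_on X nrm T \<and> bij_betw T X X \<and>
     bounded_operator_on X nrm (inv_into X T)"

definition spectrum_on ::
  "(nat \<Rightarrow> complex) set \<Rightarrow> ((nat \<Rightarrow> complex) \<Rightarrow> real)
     \<Rightarrow> ((nat \<Rightarrow> complex) \<Rightarrow> nat \<Rightarrow> complex) \<Rightarrow> complex set" where
  "spectrum_on X nrm T = {z. \<not> isomorphism_on X nrm (\<lambda>v n. T v n - z * v n)}"

definition filled_julia :: "(complex \<times> complex \<Rightarrow> complex \<times> complex) \<Rightarrow> (complex \<times> complex) set" where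
  "filled_julia f = {w. bounded (range (\<lambda>n. (f ^^ n) w))}"

definition g :: "real \<Rightarrow> complex \<times> complex \<Rightarrow> complex \<times> complex" where
  "g p = (\<lambda>(x, y). (1 / (complex_of_real p)\<^sup>2 * (x - 1 + complex_of_real p) * (y - 1 + complex_of_real p), x))"

definition E :: "real \<Rightarrow> complex set" where
  "E p = {z. (1 - complex_of_real p + (1 - z - complex_of_real p)\<^sup>2 / complex_of_real p, z)
              \<in> filled_julia (g p)}"

end

theory Submission
  imports Defs
begin

text \<open>
  The equation \<open>S v = z v\<close> is solved formally by \<open>v N = (\<Prod>i. q i ^ \<epsilon>\<^sub>i(N))\<close>, where
  \<open>q 0 = (z - 1 + p) / p\<close>, \<open>q 1 = (q 0)\<^sup>2\<close> and \<open>q (n + 2) = (q (n + 1) q n - (1 - p)) / p\<close>.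
  The affine change of variable \<open>1 - p + p q n\<close> turns this recurrence into the iteration of \<open>g\<close>,
  so \<open>z \<in> \<E>\<^sub>p\<close> means that \<open>q\<close> is bounded. Truncate \<open>v\<close> to \<open>N < F n\<close>, that is, replace \<open>q i\<close>
  by 0 for \<open>i \<ge> n\<close>. The truncation \<open>u\<close> has \<open>u 0 = 1\<close>, while \<open>S u - z u\<close> is supported on the points
  \<open>F j - 1\<close> with \<open>j \<ge> n\<close>, where it is of size \<open>O(p ^ (j div 2))\<close>. Hence \<open>S u - z u\<close> tends to 0
  in every one of the norms as \<open>n\<close> grows, and \<open>S - z\<close> has no bounded inverse.
\<close>

section \<open>Zeckendorf representations\<close>

text \<open>A digit string is encoded by the set of positions of its ones, so that its value is
  \<open>sum F A\<close> and products over digits become products over \<open>A\<close>.\<close>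

definition sparse :: "nat set \<Rightarrow> bool" where
  "sparse A \<longleftrightarrow> finite A \<and> (\<forall>i\<in>A. Suc i \<notin> A)"

definition zeck :: "nat \<Rightarrow> nat set" where
  "zeck N = {i. digit i N = 1}"

lemma F_pos: "0 < F n"
  by (induction n rule: F.induct) auto

lemma strict_mono_F: "strict_mono F"
  unfolding strict_mono_Suc_iff
proof
  fix n show "F n < F (Suc n)"
    by (cases n) (auto simp: F_pos)
qed

lemmas F_le_iff = strict_mono_less_eq[OF strict_mono_F]

lemma sparse_empty [simp]: "sparse {}"
  by (simp add: sparse_def)

lemma sparse_subset: "sparse A \<Longrightarrow> B \<subseteq> A \<Longrightarrow> sparse B"
  unfolding sparse_def using finite_subset by blast

text \<open>If the top position \<open>Suc n\<close> is used, sparsity forbids \<open>n\<close>, so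
  the rest lies below \<open>n\<close> and the recursion of \<open>F\<close> absorbs it. The strict
  bound lets the highest digit be read off from the value.\<close>

lemma sum_F_less:
  assumes "sparse A" "A \<subseteq> {..<n}"
  shows "sum F A < F n"
  using assms
proof (induction n arbitrary: A rule: F.induct)
  case 1
  then show ?case by simp
next
  case 2
  then have "sum F A \<le> sum F {0}"
    by (intro sum_mono2) auto
  then show ?case by simp
next
  case (3 n)
  show ?case
  proof (cases "Suc n \<in> A")
    case True
    have "n \<notin> A" using True "3.prems" unfolding sparse_def by blast
    then have sub: "A - {Suc n} \<subseteq> {..<n}"
      using "3.prems"(2) by (auto simp: less_Suc_eq subset_iff)
    have "sum F A = F (Suc n) + sum F (A - {Suc n})"
      using True "3.prems" by (simp add: sparse_def sum.remove)
    with "3.IH"(2)[OF sparse_subset[OF "3.prems"(1)] sub] show ?thesis by simp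
  next
    case False
    then have "A \<subseteq> {..<Suc n}"
      using "3.prems"(2) by (metis lessThan_Suc subset_insert)
    with "3.IH"(1)[OF "3.prems"(1)] show ?thesis by simp
  qed
qed

lemma F_le_sum_F: "sparse A \<Longrightarrow> i \<in> A \<Longrightarrow> F i \<le> sum F A"
  unfolding sparse_def by (intro member_le_sum) auto

text \<open>The sum alone decides the top position: \<open>n\<close> is present exactly when the sum
  reaches \<open>F n\<close>. Strip it from both sets and induct.\<close>

lemma sparse_sum_F_inj_aux:
  assumes "sparse A" "sparse B" "A \<subseteq> {..<n}" "B \<subseteq> {..<n}" "sum F A = sum F B"
  shows "A = B"
  using assms
proof (induction n arbitrary: A B)
  case 0
  then show ?case by auto
next
  case (Suc n)
  have top: "n \<in> X \<longleftrightarrow> F n \<le> sum F X" if "sparse X" "X \<subseteq> {..<Suc n}" for X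
  proof
    show "n \<in> X \<Longrightarrow> F n \<le> sum F X"
      using that F_le_sum_F by blast
    show "n \<in> X" if "F n \<le> sum F X"
    proof (rule ccontr)
      assume "n \<notin> X"
      then have "X \<subseteq> {..<n}"
        using \<open>X \<subseteq> {..<Suc n}\<close> by (metis lessThan_Suc subset_insert)
      with sum_F_less[OF \<open>sparse X\<close>] that show False by (simp add: not_le[symmetric])
    qed
  qed
  have same: "n \<in> A \<longleftrightarrow> n \<in> B"
    using top Suc.prems by metis
  have fin: "finite A" "finite B"
    using Suc.prems by (auto simp: sparse_def)
  have "A - {n} = B - {n}"
  proof (rule Suc.IH)
    show "sparse (A - {n})" "sparse (B - {n})"
      using Suc.prems sparse_subset by blast+
    show "A - {n} \<subseteq> {..<n}" "B - {n} \<subseteq> {..<n}"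
      using Suc.prems by auto
    show "sum F (A - {n}) = sum F (B - {n})"
      using Suc.prems(5) fin same by (cases "n \<in> A") (auto simp: sum_diff1_nat)
  qed
  with same show ?case by blast
qed

lemma sparse_sum_F_inj:
  assumes "sparse A" "sparse B" "sum F A = sum F B"
  shows "A = B"
proof -
  have "finite (A \<union> B)" using assms by (simp add: sparse_def)
  then obtain n where "A \<union> B \<subseteq> {..<n}"
    using finite_nat_bounded by blast
  with sparse_sum_F_inj_aux[OF assms(1,2) _ _ assms(3)] show ?thesis by blast
qed

text \<open>Greedy expansion: after \<open>F (Suc n)\<close> is subtracted the remainder is below
  \<open>F n\<close>, so its expansion lies below \<open>n\<close> and leaves the gap at
  \<open>n\<close> that sparsity demands.\<close>

lemma ex_sparse_sum_F_less:
  assumes "N < F n"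
  shows "\<exists>A\<subseteq>{..<n}. sparse A \<and> sum F A = N"
  using assms
proof (induction n arbitrary: N rule: F.induct)
  case 1
  then show ?case by (auto intro!: exI[of _ "{}"])
next
  case 2
  show ?case
  proof (cases "N = 0")
    case False
    with 2 have "N = 1" by simp
    then show ?thesis by (auto intro!: exI[of _ "{0}"] simp: sparse_def)
  qed (auto intro!: exI[of _ "{}"])
next
  case (3 n)
  show ?case
  proof (cases "N < F (Suc n)")
    case True
    from "3.IH"(1)[OF this] obtain A where A: "A \<subseteq> {..<Suc n}" "sparse A" "sum F A = N"
      by blast
    then have "A \<subseteq> {..<Suc (Suc n)}" by auto
    with A show ?thesis by blast
  next
    case False
    with "3.prems" have "N - F (Suc n) < F n" by simp
    from "3.IH"(2)[OF this] obtain A where A: "A \<subseteq> {..<n}" "sparse A" "sum F A = N - F (Suc n)"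
      by blast
    then have "Suc n \<notin> A" by auto
    then have "sum F (insert (Suc n) A) = N"
      using A False by (simp add: sparse_def)
    moreover have "sparse (insert (Suc n) A)" "insert (Suc n) A \<subseteq> {..<Suc (Suc n)}"
      using A by (auto simp: sparse_def subset_iff)
    ultimately show ?thesis by blast
  qed
qed

lemma ex_sparse_sum_F: "\<exists>A. sparse A \<and> sum F A = N"
proof -
  have "N \<le> F N" using strict_mono_imp_increasing[OF strict_mono_F] .
  then have "N < F (Suc N)" using strict_monoD[OF strict_mono_F, of N "Suc N"] by simp
  from ex_sparse_sum_F_less[OF this] show ?thesis by blast
qed

lemma fib_rep_iff:
  "fib_rep e N \<longleftrightarrow> (\<exists>A. sparse A \<and> sum F A = N \<and> e = (\<lambda>i. if i \<in> A then 1 else 0))"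
proof
  assume e: "fib_rep e N"
  let ?A = "{i. e i \<noteq> 0}"
  have e01: "e i = 0 \<or> e i = 1" for i
    using e unfolding fib_rep_def by blast
  have "finite ?A" using e unfolding fib_rep_def by blast
  moreover have "Suc i \<notin> ?A" if "i \<in> ?A" for i
  proof -
    have "\<not> (e i = 1 \<and> e (Suc i) = 1)" using e unfolding fib_rep_def by blast
    with that e01[of i] e01[of "Suc i"] show ?thesis by auto
  qed
  ultimately have "sparse ?A" unfolding sparse_def by blast
  moreover have "sum F ?A = N"
  proof -
    have "N = (\<Sum>i\<in>?A. e i * F i)" using e unfolding fib_rep_def by blast
    also have "\<dots> = sum F ?A"
    proof (rule sum.cong)
      fix i assume "i \<in> ?A"
      with e01[of i] show "e i * F i = F i" by simp
    qed simp
    finally show ?thesis by simp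
  qed
  moreover have "e = (\<lambda>i. if i \<in> ?A then 1 else 0)"
  proof
    fix i show "e i = (if i \<in> ?A then 1 else 0)" using e01[of i] by auto
  qed
  ultimately show "\<exists>A. sparse A \<and> sum F A = N \<and> e = (\<lambda>i. if i \<in> A then 1 else 0)"
    by blast
next
  assume "\<exists>A. sparse A \<and> sum F A = N \<and> e = (\<lambda>i. if i \<in> A then 1 else 0)"
  then obtain A where A: "sparse A" "sum F A = N" and e: "e = (\<lambda>i. if i \<in> A then 1 else 0)"
    by blast
  have nz: "{i. e i \<noteq> 0} = A" unfolding e by simp
  have "(\<Sum>i\<in>A. e i * F i) = sum F A"
    unfolding e by (intro sum.cong) simp_all
  with A show "fib_rep e N"
    unfolding fib_rep_def nz sparse_def by (simp add: e)
qed

text \<open>Injectivity of \<open>sum F\<close> on sparse sets resolves the definite description in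
  \<open>digit\<close>; from here on digits are handled through \<open>zeck\<close>.\<close>

lemma digit_sum_F:
  assumes "sparse A"
  shows "digit i (sum F A) = (if i \<in> A then 1 else 0)"
proof -
  have "(THE e. fib_rep e (sum F A)) = (\<lambda>i. if i \<in> A then 1 else 0)"
  proof (rule the_equality)
    show "fib_rep (\<lambda>i. if i \<in> A then 1 else 0) (sum F A)"
      unfolding fib_rep_iff using assms by blast
    fix e assume "fib_rep e (sum F A)"
    then obtain B where B: "sparse B" "sum F B = sum F A" "e = (\<lambda>i. if i \<in> B then 1 else 0)"
      unfolding fib_rep_iff by blast
    from sparse_sum_F_inj[OF B(1) assms B(2)] B(3) show "e = (\<lambda>i. if i \<in> A then 1 else 0)"
      by simp
  qed
  then show ?thesis unfolding digit_def by simp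
qed

lemma zeck_sum_F: "sparse A \<Longrightarrow> zeck (sum F A) = A"
  by (auto simp: zeck_def digit_sum_F)

lemma sparse_zeck: "sparse (zeck N)"
  and sum_F_zeck: "sum F (zeck N) = N"
proof -
  obtain A where A: "sparse A" "sum F A = N" using ex_sparse_sum_F by blast
  with zeck_sum_F[OF A(1)] show "sparse (zeck N)" "sum F (zeck N) = N" by simp_all
qed

lemma finite_zeck [simp]: "finite (zeck N)"
  using sparse_zeck[of N] by (simp add: sparse_def)

lemma digit_eq_0_iff: "digit i N = 0 \<longleftrightarrow> i \<notin> zeck N"
  using digit_sum_F[OF sparse_zeck, of i N] by (simp add: sum_F_zeck)

lemma zeck_sparse: "i \<in> zeck N \<Longrightarrow> Suc i \<notin> zeck N"
  using sparse_zeck unfolding sparse_def by blast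

section \<open>Rows of the transition matrix\<close>

text \<open>The positions \<open>k - 1, k - 3, ...\<close> down to 1 or 0. A single parity condition
  covers the blocks 10...10 (even \<open>k\<close>) and 01...01 (odd \<open>k\<close>); either has
  value \<open>F k - 1\<close>.\<close>

definition alt_digits :: "nat \<Rightarrow> nat set" where
  "alt_digits k = {i. i < k \<and> odd (i + k)}"

text \<open>The row types (2) and (3) are the even values of \<open>j\<close>, (5) and (4) the odd ones:
  adding 1 to \<open>N\<close> clears the digits below \<open>j\<close> and sets digit \<open>j\<close>.\<close>

definition carry_at :: "nat \<Rightarrow> nat \<Rightarrow> bool" where
  "carry_at j N \<longleftrightarrow> zeck N \<inter> {..Suc j} = alt_digits j"

lemma finite_alt_digits [simp]: "finite (alt_digits k)"
  by (rule finite_subset[of _ "{..<k}"]) (auto simp: alt_digits_def)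

lemma alt_digits_0 [simp]: "alt_digits 0 = {}"
  by (simp add: alt_digits_def)

lemma alt_digits_1 [simp]: "alt_digits (Suc 0) = {0}"
  by (auto simp: alt_digits_def)

lemma alt_digits_Suc_Suc: "alt_digits (Suc (Suc k)) = insert (Suc k) (alt_digits k)"
  by (auto simp: alt_digits_def less_Suc_eq)

lemma Suc_notin_alt_digits [simp]: "Suc k \<notin> alt_digits k"
  by (simp add: alt_digits_def)

lemma sum_F_alt_digits: "Suc (sum F (alt_digits k)) = F k"
  by (induction k rule: F.induct) (auto simp: alt_digits_Suc_Suc)

lemma alt_digits_mono: "k \<le> j \<Longrightarrow> even (j + k) \<Longrightarrow> alt_digits k \<subseteq> alt_digits j"
  by (auto simp: alt_digits_def)

lemma carry_at_iff:
  "carry_at j N \<longleftrightarrow> j \<notin> zeck N \<and> Suc j \<notin> zeck N \<and> (\<forall>i<j. i \<in> zeck N \<longleftrightarrow> odd (i + j))"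
  (is "?L \<longleftrightarrow> ?R")
proof -
  have "?L \<longleftrightarrow> (\<forall>i\<le>Suc j. i \<in> zeck N \<longleftrightarrow> i < j \<and> odd (i + j))"
    unfolding carry_at_def alt_digits_def by auto
  also have "\<dots> \<longleftrightarrow> ?R"
    by (auto simp: order_le_less less_Suc_eq)
  finally show ?thesis .
qed

text \<open>The two adjacent zeros at \<open>i\<close> and \<open>Suc i\<close> cannot fit into the
  alternating pattern that a larger \<open>j\<close> imposes below itself.\<close>

lemma carry_at_unique:
  assumes "carry_at i N" "carry_at j N"
  shows "i = j"
proof (rule ccontr)
  assume "i \<noteq> j"
  moreover have False if "i < j" "carry_at i N" "carry_at j N" for i j
  proof -
    from that have "i \<notin> zeck N" "Suc i \<notin> zeck N" "j \<notin> zeck N"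
      and alt: "\<And>k. k < j \<Longrightarrow> k \<in> zeck N \<longleftrightarrow> odd (k + j)"
      by (auto simp: carry_at_iff)
    with \<open>i < j\<close> alt[of i] have "even (i + j)" by simp
    with \<open>i < j\<close> have "Suc i < j" by (cases "j = Suc i") auto
    with alt[of "Suc i"] \<open>Suc i \<notin> zeck N\<close> \<open>even (i + j)\<close> show False by simp
  qed
  ultimately show False using assms by (metis nat_neq_iff)
qed

text \<open>Take the lowest pair of adjacent zeros. Below it minimality excludes two adjacent zeros
  and sparsity excludes two adjacent ones, so the digits alternate downwards from the zero at
  \<open>j\<close>.\<close>

lemma ex_carry_at: "\<exists>j. carry_at j N"
proof -
  let ?P = "\<lambda>j. j \<notin> zeck N \<and> Suc j \<notin> zeck N"
  obtain n where "zeck N \<subseteq> {..<n}"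
    using finite_nat_bounded[OF finite_zeck] by blast
  then have "?P n" by auto
  then obtain j where P: "?P j" and min: "\<And>i. i < j \<Longrightarrow> \<not> ?P i"
    using exists_least_iff[of ?P] by blast
  have alt: "j - d \<in> zeck N \<longleftrightarrow> odd d" if "d \<le> j" for d
    using that
  proof (induction d)
    case 0
    with P show ?case by simp
  next
    case (Suc d)
    then have eq: "Suc (j - Suc d) = j - d" and "j - Suc d < j" by simp_all
    with min[of "j - Suc d"] zeck_sparse[of "j - Suc d" N]
    have "j - Suc d \<in> zeck N \<longleftrightarrow> j - d \<notin> zeck N" unfolding eq by blast
    with Suc.IH Suc.prems show ?case by simp
  qed
  have "i \<in> zeck N \<longleftrightarrow> odd (i + j)" if "i < j" for i
    using that alt[of "j - i"] by (auto simp: even_diff_nat)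
  with P have "carry_at j N" by (simp add: carry_at_iff)
  then show ?thesis ..
qed

text \<open>The zeros inside the block, on which \<open>ends_10\<close> is silent, come from
  sparsity. The case \<open>s = 0\<close> is row type (2).\<close>

lemma ends_10_iff: "ends_10 s N \<longleftrightarrow> carry_at (2 * s) N"
proof
  assume e: "ends_10 s N"
  have low: "2 * k + 1 \<in> zeck N" if "k < s" for k
  proof -
    have "Suc k \<in> {1..s}" using that by simp
    with e have "digit (2 * Suc k - 1) N = 1" unfolding ends_10_def by blast
    then show ?thesis by (simp add: zeck_def)
  qed
  have "i \<in> zeck N \<longleftrightarrow> odd (i + 2 * s)" if "i < 2 * s" for i
  proof (cases "odd i")
    case True
    then obtain k where k: "i = 2 * k + 1" by (rule oddE)
    with that low[of k] True show ?thesis by simp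
  next
    case False
    then obtain k where k: "i = 2 * k" by (metis evenE)
    with that low[of k] zeck_sparse[of i N] False show ?thesis by auto
  qed
  moreover have "2 * s \<notin> zeck N" "Suc (2 * s) \<notin> zeck N"
    using e unfolding ends_10_def by (simp_all add: zeck_def)
  ultimately show "carry_at (2 * s) N"
    unfolding carry_at_iff by blast
next
  assume c: "carry_at (2 * s) N"
  have "digit (2 * i - 1) N = 1" if "i \<in> {1..s}" for i
  proof -
    have "2 * i - 1 < 2 * s" "odd (2 * i - 1 + 2 * s)" using that by auto
    with c have "2 * i - 1 \<in> zeck N" unfolding carry_at_iff by blast
    then show ?thesis by (simp add: zeck_def)
  qed
  moreover have "digit (2 * s) N = 0" "digit (2 * s + 1) N = 0"
    using c by (simp_all add: carry_at_iff digit_eq_0_iff)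
  ultimately show "ends_10 s N"
    unfolding ends_10_def by blast
qed

text \<open>Writing \<open>s = Suc t\<close> keeps \<open>2 * s - 1\<close> free of truncation;
  \<open>t = 0\<close> is row type (5).\<close>

lemma ends_01_iff: "ends_01 (Suc t) N \<longleftrightarrow> carry_at (2 * t + 1) N"
proof
  assume e: "ends_01 (Suc t) N"
  have low: "2 * k \<in> zeck N" if "k \<le> t" for k
    using e that unfolding ends_01_def by (simp add: zeck_def)
  have "i \<in> zeck N \<longleftrightarrow> odd (i + (2 * t + 1))" if "i < 2 * t + 1" for i
  proof (cases "even i")
    case True
    then obtain k where k: "i = 2 * k" by (rule evenE)
    with that low[of k] True show ?thesis by simp
  next
    case False
    then obtain k where k: "i = 2 * k + 1" by (rule oddE)
    with that low[of k] zeck_sparse[of "2 * k" N] False show ?thesis by auto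
  qed
  moreover have "2 * t + 1 \<notin> zeck N" "Suc (2 * t + 1) \<notin> zeck N"
    using e unfolding ends_01_def by (simp_all add: zeck_def)
  ultimately show "carry_at (2 * t + 1) N"
    unfolding carry_at_iff by blast
next
  assume c: "carry_at (2 * t + 1) N"
  have "digit (2 * i) N = 1" if "i < Suc t" for i
  proof -
    have "2 * i < 2 * t + 1" "odd (2 * i + (2 * t + 1))" using that by auto
    with c have "2 * i \<in> zeck N" unfolding carry_at_iff by blast
    then show ?thesis by (simp add: zeck_def)
  qed
  moreover have "digit (2 * Suc t - 1) N = 0" "digit (2 * Suc t) N = 0"
    using c by (simp_all add: carry_at_iff digit_eq_0_iff)
  ultimately show "ends_01 (Suc t) N"
    unfolding ends_01_def by blast
qed

text \<open>All row types in one formula. The parity of \<open>j\<close> selects the family of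
  rules; for odd \<open>j\<close> the index of \<open>back_01\<close> is shifted by one, after which
  both families share the exponents and the range of \<open>m\<close>.\<close>

lemma transition_iff:
  assumes "carry_at j N"
  shows "transition p N M r \<longleftrightarrow>
    M = N \<and> r = 1 - p \<or> M = N + 1 \<and> r = p ^ (j div 2 + 1) \<or>
    (\<exists>m\<in>{1..j div 2}. M = N + 1 - F (2 * m + j mod 2) \<and> r = p ^ m * (1 - p))"
    (is "_ \<longleftrightarrow> ?R")
proof
  assume "transition p N M r"
  then show ?R
  proof cases
    case stay
    then show ?thesis by simp
  next
    case succ_00
    then have "ends_10 0 N" by (simp add: ends_10_def)
    with assms have "j = 0" using carry_at_unique by (simp add: ends_10_iff)
    with succ_00 show ?thesis by simp
  next
    case (succ_10 s)
    with assms have "j = 2 * s" using carry_at_unique by (simp add: ends_10_iff)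
    with succ_10 show ?thesis by simp
  next
    case (back_10 s m)
    with assms have "j = 2 * s" using carry_at_unique by (simp add: ends_10_iff)
    with back_10 show ?thesis by (auto intro!: bexI[of _ m])
  next
    case (succ_01 s)
    then obtain t where t: "s = Suc t" by (cases s) auto
    with succ_01 assms have "j = 2 * t + 1"
      using carry_at_unique ends_01_iff by blast
    with succ_01 t show ?thesis by simp
  next
    case (back_01 s m)
    then obtain t where t: "s = Suc t" by (cases s) auto
    with back_01 assms have j: "j = 2 * t + 1"
      using carry_at_unique ends_01_iff by blast
    have "m - 1 \<in> {1..t}" "2 * (m - 1) + 1 = 2 * m - 1" using back_01 t by auto
    with back_01 j show ?thesis by (auto intro!: bexI[of _ "m - 1"])
  next
    case succ_001
    then have "ends_01 (Suc 0) N" by (simp add: ends_01_def)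
    with assms have "j = 1" using carry_at_unique ends_01_iff[of 0] by force
    with succ_001 show ?thesis by simp
  qed
next
  assume R: ?R
  show "transition p N M r"
  proof (cases "even j")
    case True
    then obtain s where j: "j = 2 * s" by auto
    then have e: "ends_10 s N" using assms by (simp add: ends_10_iff)
    show ?thesis
    proof (cases "s = 0")
      case True
      with R j e show ?thesis
        using transition.succ_00[of N p] by (auto simp: ends_10_def intro: transition.stay)
    next
      case False
      have "transition p N (N + 1 - F (2 * m)) (p ^ m * (1 - p))" if "m \<in> {1..s}" for m
        using transition.back_10[of s N m p] that e False by simp
      moreover have "transition p N (N + 1) (p ^ Suc s)"
        using transition.succ_10[of s N p] e False by simp
      ultimately show ?thesis
        using R j by (auto intro: transition.stay)
    qed
  next
    case False
    then obtain t where j: "j = 2 * t + 1" by (elim oddE)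
    then have e: "ends_01 (Suc t) N" using assms by (simp add: ends_01_iff)
    show ?thesis
    proof (cases "t = 0")
      case True
      with R j e show ?thesis
        using transition.succ_001[of N p]
        by (auto simp: ends_01_def numeral_2_eq_2 intro: transition.stay)
    next
      case False
      have "transition p N (N + 1 - F (2 * m + 1)) (p ^ m * (1 - p))" if "m \<in> {1..t}" for m
        using transition.back_01[of "Suc t" N "Suc m" p] that e False by simp
      moreover have "transition p N (N + 1) (p ^ Suc t)"
        using transition.succ_01[of "Suc t" N p] e False by simp
      ultimately show ?thesis
        using R j by (auto intro: transition.stay)
    qed
  qed
qed

section \<open>Rows as explicit finite sums\<close>

lemma zeck_carry_split:
  assumes "carry_at j N"
  shows "zeck N = alt_digits j \<union> (zeck N - {..Suc j})"
  using assms unfolding carry_at_def by blast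

lemma Suc_carry:
  assumes "carry_at j N"
  shows "N + 1 = F j + sum F (zeck N - {..Suc j})"
proof -
  have "N = sum F (zeck N)" by (simp add: sum_F_zeck)
  also have "\<dots> = sum F (alt_digits j) + sum F (zeck N - {..Suc j})"
    by (subst zeck_carry_split[OF assms], subst sum.union_disjoint)
      (auto simp: alt_digits_def)
  finally show ?thesis using sum_F_alt_digits[of j] by simp
qed

lemma S_matrix_eqI:
  assumes "\<And>r. transition p N M r \<longleftrightarrow> r = a"
  shows "S_matrix p N M = a"
proof -
  have "transition p N M = (\<lambda>r. r = a)" using assms by blast
  then show ?thesis by (simp add: S_matrix_def)
qed

text \<open>The targets are pairwise distinct, which settles the description in
  \<open>S_matrix\<close> and reduces the series to a finite sum. Incomplete carries land strictly
  below \<open>N\<close> because the subtracted number is at least 3, and at different places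
  because \<open>F\<close> is injective and the subtraction is never truncated.\<close>

lemma S_row:
  assumes "carry_at j N"
  shows "S p v N = of_real (1 - p) * v N + of_real (p ^ (j div 2 + 1)) * v (N + 1) +
    (\<Sum>m=1..j div 2. of_real (p ^ m * (1 - p)) * v (N + 1 - F (2 * m + j mod 2)))"
proof -
  define T where "T m = N + 1 - F (2 * m + j mod 2)" for m
  have F_le: "F (2 * m + j mod 2) \<le> N + 1" if "m \<in> {1..j div 2}" for m
  proof -
    have "2 * m \<le> 2 * (j div 2)" using that by simp
    then have "2 * m + j mod 2 \<le> j" using mult_div_mod_eq[of 2 j] by linarith
    then have "F (2 * m + j mod 2) \<le> F j" by (simp add: F_le_iff)
    with Suc_carry[OF assms] show ?thesis by simp
  qed
  have F_ge: "3 \<le> F (2 * m + j mod 2)" if "m \<in> {1..j div 2}" for m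
  proof -
    have "F 2 \<le> F (2 * m + j mod 2)" using that by (simp add: F_le_iff)
    then show ?thesis by (simp add: numeral_2_eq_2)
  qed
  have T_less: "T m < N" if "m \<in> {1..j div 2}" for m
    using F_le[OF that] F_ge[OF that] by (simp add: T_def)
  have inj: "inj_on T {1..j div 2}"
  proof (rule inj_onI)
    fix m n assume "m \<in> {1..j div 2}" "n \<in> {1..j div 2}" "T m = T n"
    with F_le[of m] F_le[of n] have "F (2 * m + j mod 2) = F (2 * n + j mod 2)"
      by (simp add: T_def)
    then show "m = n" using strict_mono_eq[OF strict_mono_F] by simp
  qed
  note iff = transition_iff[OF assms, folded T_def]
  have 1: "S_matrix p N N = 1 - p"
  proof -
    have "transition p N N r \<longleftrightarrow> r = 1 - p" for r
      using T_less unfolding iff by (metis less_irrefl n_not_Suc_n Suc_eq_plus1)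
    then show ?thesis by (rule S_matrix_eqI)
  qed
  have 2: "S_matrix p N (N + 1) = p ^ (j div 2 + 1)"
  proof -
    have "transition p N (N + 1) r \<longleftrightarrow> r = p ^ (j div 2 + 1)" for r
      using T_less by (fastforce simp: iff)
    then show ?thesis by (rule S_matrix_eqI)
  qed
  have 3: "S_matrix p N (T m) = p ^ m * (1 - p)" if m: "m \<in> {1..j div 2}" for m
  proof -
    have "transition p N (T m) r \<longleftrightarrow> r = p ^ m * (1 - p)" for r
      using T_less[OF m] m inj_onD[OF inj _ m] by (auto simp: iff)
    then show ?thesis by (rule S_matrix_eqI)
  qed
  let ?A = "insert N (insert (N + 1) (T ` {1..j div 2}))"
  have 4: "S_matrix p N M = 0" if "M \<notin> ?A" for M
    using that by (auto simp: S_matrix_def iff)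
  have "S p v N = (\<Sum>M\<in>?A. of_real (S_matrix p N M) * v M)"
    unfolding S_def by (rule suminf_finite) (auto simp: 4)
  also have "\<dots> = of_real (S_matrix p N N) * v N + (of_real (S_matrix p N (N + 1)) * v (N + 1)
      + (\<Sum>M\<in>T ` {1..j div 2}. of_real (S_matrix p N M) * v M))"
  proof -
    have "N \<notin> insert (N + 1) (T ` {1..j div 2})" "N + 1 \<notin> T ` {1..j div 2}"
      using T_less by fastforce+
    then show ?thesis by simp
  qed
  also have "(\<Sum>M\<in>T ` {1..j div 2}. of_real (S_matrix p N M) * v M)
      = (\<Sum>m=1..j div 2. of_real (p ^ m * (1 - p)) * v (T m))"
    unfolding sum.reindex[OF inj] comp_def by (intro sum.cong refl) (simp only: 3)
  finally show ?thesis unfolding 1 2 T_def by (simp only: add.assoc)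
qed

section \<open>Product vectors\<close>

definition zprod :: "(nat \<Rightarrow> complex) \<Rightarrow> nat \<Rightarrow> complex" where
  "zprod a N = (\<Prod>i\<in>zeck N. a i)"

lemma alt_digits_subset: "m \<le> j div 2 \<Longrightarrow> alt_digits (2 * m + j mod 2) \<subseteq> alt_digits j"
proof (rule alt_digits_mono)
  assume "m \<le> j div 2"
  then show "2 * m + j mod 2 \<le> j" using mult_div_mod_eq[of 2 j] by linarith
  show "even (j + (2 * m + j mod 2))" by (cases "even j") auto
qed

lemma zprod_carry:
  assumes "carry_at j N"
  shows "zprod a N = (\<Prod>i\<in>alt_digits j. a i) * (\<Prod>i\<in>zeck N - {..Suc j}. a i)"
  unfolding zprod_def
  by (subst zeck_carry_split[OF assms], subst prod.union_disjoint) (auto simp: alt_digits_def)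

text \<open>The block worth \<open>F j - 1\<close> plus 1 becomes the single digit \<open>j\<close>.
  The remaining digits start at \<open>j + 2\<close> or later, so the new set is still sparse and is
  the expansion of \<open>N + 1\<close>.\<close>

lemma zprod_Suc_carry:
  assumes "carry_at j N"
  shows "zprod a (N + 1) = a j * (\<Prod>i\<in>zeck N - {..Suc j}. a i)"
proof -
  let ?B = "zeck N - {..Suc j}"
  have "sparse (insert j ?B)"
    using sparse_zeck[of N] by (auto simp: sparse_def)
  moreover have "sum F (insert j ?B) = N + 1"
    using Suc_carry[OF assms] by simp
  ultimately have "zeck (N + 1) = insert j ?B"
    using zeck_sum_F by metis
  then show ?thesis by (simp add: zprod_def)
qed

text \<open>Since \<open>alt_digits k\<close> is worth \<open>F k - 1\<close>, an incomplete carry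
  only erases that lower part of the block.\<close>

lemma zprod_back_carry:
  assumes "carry_at j N" "alt_digits k \<subseteq> alt_digits j"
  shows "zprod a (N + 1 - F k) =
    (\<Prod>i\<in>alt_digits j - alt_digits k. a i) * (\<Prod>i\<in>zeck N - {..Suc j}. a i)"
proof -
  let ?B = "zeck N - {..Suc j}" and ?A = "alt_digits j - alt_digits k"
  have disj: "?A \<inter> ?B = {}" by (auto simp: alt_digits_def)
  have "?A \<union> ?B \<subseteq> zeck N"
    using zeck_carry_split[OF assms(1)] by blast
  then have "sparse (?A \<union> ?B)"
    using sparse_subset[OF sparse_zeck] by blast
  moreover have "sum F (?A \<union> ?B) = N + 1 - F k"
  proof -
    have "sum F (alt_digits j) = sum F ?A + sum F (alt_digits k)"
      using assms(2) by (intro sum.subset_diff) auto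
    then show ?thesis
      using Suc_carry[OF assms(1)] sum_F_alt_digits[of j] sum_F_alt_digits[of k] disj
      by (simp add: sum.union_disjoint)
  qed
  ultimately have "zeck (N + 1 - F k) = ?A \<union> ?B"
    using zeck_sum_F by metis
  then show ?thesis
    using disj by (simp add: zprod_def prod.union_disjoint)
qed

text \<open>
  Row \<open>N\<close> of \<open>S p (zprod a) - z * zprod a\<close>, divided by the common factor contributed by the
  digits of \<open>N\<close> beyond \<open>j + 1\<close>; the three summands are the diagonal entry, the successor
  and the incomplete carries.
\<close>

definition row_defect :: "real \<Rightarrow> complex \<Rightarrow> (nat \<Rightarrow> complex) \<Rightarrow> nat \<Rightarrow> complex" where
  "row_defect p z a j =
    (of_real (1 - p) - z) * (\<Prod>i\<in>alt_digits j. a i) + of_real (p ^ (j div 2 + 1)) * a j +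
    (\<Sum>m=1..j div 2. of_real (p ^ m * (1 - p)) *
      (\<Prod>i\<in>alt_digits j - alt_digits (2 * m + j mod 2). a i))"

lemma S_zprod:
  assumes "carry_at j N"
  shows "S p (zprod a) N - z * zprod a N =
    row_defect p z a j * (\<Prod>i\<in>zeck N - {..Suc j}. a i)"
proof -
  let ?W = "\<Prod>i\<in>zeck N - {..Suc j}. a i"
  have "(\<Sum>m=1..j div 2. of_real (p ^ m * (1 - p)) * zprod a (N + 1 - F (2 * m + j mod 2)))
    = (\<Sum>m=1..j div 2. of_real (p ^ m * (1 - p)) *
        ((\<Prod>i\<in>alt_digits j - alt_digits (2 * m + j mod 2). a i) * ?W))"
    by (intro sum.cong refl arg_cong2[of _ _ _ _ times]
        zprod_back_carry[OF assms] alt_digits_subset) simp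
  then show ?thesis
    unfolding S_row[OF assms] row_defect_def zprod_carry[OF assms] zprod_Suc_carry[OF assms]
    by (simp add: algebra_simps sum_distrib_left)
qed

lemma alt_digits_Diff_Suc_Suc:
  assumes "m \<le> k div 2"
  shows "alt_digits (Suc (Suc k)) - alt_digits (2 * m + k mod 2) =
    insert (Suc k) (alt_digits k - alt_digits (2 * m + k mod 2))"
  using alt_digits_subset[OF assms] by (auto simp: alt_digits_Suc_Suc)

text \<open>Going from \<open>k\<close> to \<open>k + 2\<close> puts position \<open>Suc k\<close>
  into the block, which multiplies the diagonal and backward terms by \<open>a (Suc k)\<close>. One
  backward term is new, with empty product because it erases the whole block, and the successor term
  is exchanged; the last bracket collects these two changes.\<close>

lemma row_defect_Suc_Suc:
  "row_defect p z a (Suc (Suc k)) =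
    a (Suc k) * row_defect p z a k +
    of_real (p ^ (k div 2 + 1)) * (of_real p * a (Suc (Suc k)) + of_real (1 - p) - a (Suc k) * a k)"
proof -
  let ?G = "\<lambda>m. alt_digits k - alt_digits (2 * m + k mod 2)"
  have ins: "(\<Prod>i\<in>insert (Suc k) A. a i) = a (Suc k) * (\<Prod>i\<in>A. a i)" if "A \<subseteq> alt_digits k" for A
    using that finite_subset[OF that] by (subst prod.insert) auto
  have "alt_digits (Suc (Suc k)) - alt_digits (2 * Suc (k div 2) + k mod 2) = {}"
  proof -
    have "2 * Suc (k div 2) + k mod 2 = Suc (Suc k)" by simp
    then show ?thesis by simp
  qed
  moreover have "(\<Prod>i\<in>alt_digits (Suc (Suc k)) - alt_digits (2 * m + k mod 2). a i)
      = a (Suc k) * (\<Prod>i\<in>?G m. a i)" if "m \<in> {1..k div 2}" for m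
    using that by (simp add: alt_digits_Diff_Suc_Suc ins)
  ultimately have "(\<Sum>m=1..Suc (k div 2). of_real (p ^ m * (1 - p)) *
      (\<Prod>i\<in>alt_digits (Suc (Suc k)) - alt_digits (2 * m + k mod 2). a i))
    = (\<Sum>m=1..k div 2. of_real (p ^ m * (1 - p)) * (a (Suc k) * (\<Prod>i\<in>?G m. a i)))
      + of_real (p ^ Suc (k div 2) * (1 - p))"
    by simp
  then show ?thesis
    unfolding row_defect_def alt_digits_Suc_Suc[of k]
    by (simp add: ins alt_digits_Suc_Suc algebra_simps sum_distrib_left)
qed

text \<open>The first two values solve the rows \<open>j = 0\<close> and \<open>j = 1\<close>; the
  recursion annihilates the bracket in \<open>row_defect_Suc_Suc\<close>.\<close>

fun weight :: "real \<Rightarrow> complex \<Rightarrow> nat \<Rightarrow> complex" where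
  "weight p z 0 = (z - 1 + of_real p) / of_real p"
| "weight p z (Suc 0) = (weight p z 0)\<^sup>2"
| "weight p z (Suc (Suc n)) =
    (weight p z (Suc n) * weight p z n - of_real (1 - p)) / of_real p"

lemma row_defect_weight:
  assumes "p \<noteq> 0"
  shows "row_defect p z (weight p z) j = 0"
proof (induction j rule: F.induct)
  case 1
  then show ?case using assms by (simp add: row_defect_def)
next
  case 2
  then show ?case using assms by (simp add: row_defect_def power2_eq_square field_simps)
next
  case (3 n)
  then show ?case using assms by (simp add: row_defect_Suc_Suc)
qed

section \<open>Defects of the truncated weights\<close>

definition cut :: "nat \<Rightarrow> (nat \<Rightarrow> complex) \<Rightarrow> nat \<Rightarrow> complex" where
  "cut n a i = (if i < n then a i else 0)"

lemma row_defect_cong: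
  assumes "\<And>i. i \<le> j \<Longrightarrow> a i = b i"
  shows "row_defect p z a j = row_defect p z b j"
  unfolding row_defect_def using assms
  by (intro arg_cong2[of _ _ _ _ plus] arg_cong2[of _ _ _ _ times] sum.cong prod.cong refl)
    (auto simp: alt_digits_def)

lemma row_defect_cut_less:
  assumes "p \<noteq> 0" "j < n"
  shows "row_defect p z (cut n (weight p z)) j = 0"
  using row_defect_cong[of j "cut n (weight p z)" "weight p z"] row_defect_weight[OF assms(1)] assms(2)
  by (simp add: cut_def)

text \<open>Position \<open>j\<close> does not belong to \<open>alt_digits j\<close>, so
  \<open>a j\<close> enters only through the successor term.\<close>

lemma row_defect_fun_upd:
  "row_defect p z (a(j := 0)) j = row_defect p z a j - of_real (p ^ (j div 2 + 1)) * a j"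
proof -
  have "(\<Prod>i\<in>A. (a(j := 0)) i) = (\<Prod>i\<in>A. a i)" if "A \<subseteq> alt_digits j" for A
    using that by (intro prod.cong) (auto simp: alt_digits_def)
  then show ?thesis by (simp add: row_defect_def)
qed

lemma row_defect_cut_eq:
  assumes "p \<noteq> 0"
  shows "row_defect p z (cut n (weight p z)) n = - of_real (p ^ (n div 2 + 1)) * weight p z n"
  using row_defect_cong[of n "cut n (weight p z)" "(weight p z)(n := 0)"]
    row_defect_fun_upd[of p z "weight p z" n] row_defect_weight[OF assms]
  by (simp add: cut_def)

text \<open>Both \<open>cut n a (Suc k)\<close> and \<open>cut n a (Suc (Suc k))\<close> vanish,
  which leaves only the backward term that erases the whole block.\<close>

lemma row_defect_cut_greater:
  assumes "n \<le> Suc k"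
  shows "row_defect p z (cut n a) (Suc (Suc k)) = of_real (p ^ (k div 2 + 1) * (1 - p))"
  using assms by (simp add: row_defect_Suc_Suc cut_def)

lemma norm_row_defect_cut:
  assumes p: "0 < p" "p < 1" and n: "0 < n" and K: "1 \<le> K" "cmod (weight p z n) \<le> K"
  shows "cmod (row_defect p z (cut n (weight p z)) j) \<le> (if j < n then 0 else K * p ^ (j div 2))"
proof (cases j n rule: linorder_cases)
  case less
  with p show ?thesis by (simp add: row_defect_cut_less)
next
  case equal
  have "p ^ (n div 2 + 1) * cmod (weight p z n) \<le> p ^ (n div 2) * K"
    using p K by (intro mult_mono power_decreasing) auto
  with p equal show ?thesis by (simp add: row_defect_cut_eq norm_mult norm_power mult.commute)
next
  case greater
  \<comment> \<open>Here \<open>0 < n < j\<close> forces \<open>j\<close> to be at least 2, so the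
    two-step recursion applies.\<close>
  with n obtain k where k: "j = Suc (Suc k)"
    by (metis less_imp_Suc_add not0_implies_Suc less_not_refl add_is_0)
  have "p ^ (k div 2 + 1) * (1 - p) \<le> p ^ (k div 2 + 1) * K"
    using p K by (intro mult_left_mono) auto
  moreover have "cmod (row_defect p z (cut n (weight p z)) j) = p ^ (k div 2 + 1) * (1 - p)"
    using row_defect_cut_greater[of n k p z "weight p z"] greater k p
    by (simp del: of_real_mult of_real_power of_real_diff)
  ultimately show ?thesis using greater k by (simp add: mult.commute)
qed

section \<open>Approximate eigenvectors\<close>

lemma zprod_0: "zprod a 0 = 1"
  using zeck_sum_F[of "{}"] by (simp add: zprod_def)

lemma prod_cut_eq_0:
  assumes "finite A" "i \<in> A" "n \<le> i"
  shows "prod (cut n a) A = 0"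
proof -
  have "cut n a i = 0" using assms(3) by (simp add: cut_def)
  with assms(1,2) show ?thesis by (intro prod_zero) blast+
qed

lemma zprod_cut_eq_0:
  assumes "F n \<le> N"
  shows "zprod (cut n a) N = 0"
proof -
  have "\<not> zeck N \<subseteq> {..<n}"
    using sum_F_less[OF sparse_zeck, of N n] assms unfolding sum_F_zeck by linarith
  then obtain i where "i \<in> zeck N" "n \<le> i" by (meson lessThan_iff not_less subsetI)
  then show ?thesis
    unfolding zprod_def by (rule prod_cut_eq_0[OF finite_zeck])
qed

lemma strict_mono_F_minus_1: "strict_mono (\<lambda>j. F j - 1)"
  unfolding strict_mono_Suc_iff
proof
  fix n
  have "F n < F (Suc n)" using strict_monoD[OF strict_mono_F, of n "Suc n"] by simp
  with F_pos[of n] show "F n - 1 < F (Suc n) - 1" by simp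
qed

lemma carry_at_F_minus_1: "carry_at j (F j - 1)"
proof -
  have "sparse (alt_digits j)" by (auto simp: sparse_def alt_digits_def)
  moreover have "F j - 1 = sum F (alt_digits j)" using sum_F_alt_digits[of j] by simp
  ultimately have "zeck (F j - 1) = alt_digits j" by (simp add: zeck_sum_F)
  moreover have "alt_digits j \<inter> {..Suc j} = alt_digits j" by (auto simp: alt_digits_def)
  ultimately show ?thesis by (simp add: carry_at_def)
qed

text \<open>Meant for \<open>p = t ^ 4\<close>: half of the decay of \<open>p ^ (j div 2)\<close> is
  spent on smallness in \<open>n\<close>, the other half on summability in \<open>j\<close>.
  Dividing by \<open>t\<^sup>2\<close> pays for the rounding in \<open>j div 2\<close>.\<close>

lemma power_half_le:
  fixes t :: real
  assumes "0 < t" "t < 1" "n \<le> j"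
  shows "(t ^ 4) ^ (j div 2) \<le> t ^ n * t ^ j / t\<^sup>2"
proof -
  have "2 * j \<le> 4 * (j div 2) + 2" by linarith
  have "(t ^ 4) ^ (j div 2) * t\<^sup>2 = t ^ (4 * (j div 2) + 2)"
    by (simp only: power_mult power_add)
  also have "\<dots> \<le> t ^ (n + j)"
    using assms \<open>2 * j \<le> _\<close> by (intro power_decreasing) auto
  finally show ?thesis using assms by (simp add: power_add pos_le_divide_eq)
qed

text \<open>If \<open>N\<close> is not of the form \<open>F j - 1\<close>, it has a digit above its
  carry position \<open>j\<close>. For \<open>j < n\<close> the defect vanishes; for
  \<open>j \<ge> n\<close> that higher digit meets a zero of \<open>cut\<close>. At
  \<open>F j - 1\<close> there are no higher digits and the bare defect remains.\<close>

lemma S_zprod_cut: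
  assumes p: "0 < p" "p < 1" and n: "0 < n" and K: "1 \<le> K" "cmod (weight p z n) \<le> K"
    and t: "0 < t" "t < 1" "p = t ^ 4"
  defines "v \<equiv> zprod (cut n (weight p z))"
  shows "N \<notin> range (\<lambda>j. F j - 1) \<Longrightarrow> S p v N - z * v N = 0"
    and "cmod (S p v (F j - 1) - z * v (F j - 1)) \<le> K / t\<^sup>2 * t ^ n * t ^ j"
proof -
  let ?a = "cut n (weight p z)"
  let ?W = "\<lambda>j N. \<Prod>i\<in>zeck N - {..Suc j}. ?a i"
  have eq: "S p v N - z * v N = row_defect p z ?a j * ?W j N" if "carry_at j N" for j N
    unfolding v_def by (rule S_zprod[OF that])
  have defect: "cmod (row_defect p z ?a j) \<le> (if j < n then 0 else K * p ^ (j div 2))" for j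
    by (rule norm_row_defect_cut[OF p n K])
  show "S p v N - z * v N = 0" if N: "N \<notin> range (\<lambda>j. F j - 1)"
  proof -
    obtain j where j: "carry_at j N" using ex_carry_at by blast
    have ne: "zeck N - {..Suc j} \<noteq> {}"
    proof
      assume "zeck N - {..Suc j} = {}"
      with Suc_carry[OF j] have "N + 1 = F j" by simp
      then have "N = F j - 1" by simp
      with N show False by blast
    qed
    show ?thesis
    proof (cases "j < n")
      case True
      with defect[of j] show ?thesis by (simp add: eq[OF j])
    next
      case False
      from ne obtain i where i: "i \<in> zeck N - {..Suc j}" by blast
      with False have "n \<le> i" by simp
      with i have "?W j N = 0" by (intro prod_cut_eq_0[of _ i]) simp_all
      then show ?thesis by (simp add: eq[OF j])
    qed
  qed
  have "zeck (F j - 1) - {..Suc j} = {}"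
  proof (rule ccontr)
    assume "zeck (F j - 1) - {..Suc j} \<noteq> {}"
    then obtain i where "i \<in> zeck (F j - 1) - {..Suc j}" by blast
    then have i: "i \<in> zeck (F j - 1)" "Suc j < i" by simp_all
    have "F i \<le> F j - 1" using F_le_sum_F[OF sparse_zeck i(1)] by (simp add: sum_F_zeck)
    moreover have "F j \<le> F i" using i by (simp add: F_le_iff)
    ultimately show False using F_pos[of j] by linarith
  qed
  then have "S p v (F j - 1) - z * v (F j - 1) = row_defect p z ?a j"
    by (simp only: eq[OF carry_at_F_minus_1] prod.empty mult_1_right)
  moreover have "cmod (row_defect p z ?a j) \<le> K / t\<^sup>2 * t ^ n * t ^ j"
  proof (cases "j < n")
    case True
    with defect[of j] t K show ?thesis by simp
  next
    case False
    then have "cmod (row_defect p z ?a j) \<le> K * p ^ (j div 2)" using defect[of j] by simp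
    also have "\<dots> \<le> K * (t ^ n * t ^ j / t\<^sup>2)"
      using False K power_half_le[OF t(1,2), of n j] unfolding t(3) by (intro mult_left_mono) auto
    finally show ?thesis by simp
  qed
  ultimately show "cmod (S p v (F j - 1) - z * v (F j - 1)) \<le> K / t\<^sup>2 * t ^ n * t ^ j"
    by simp
qed

section \<open>The Julia set condition as boundedness of the weights\<close>

lemma g_iterate_weight:
  assumes "p \<noteq> 0"
  shows "(g p ^^ n) (1 - of_real p + (1 - z - of_real p)\<^sup>2 / of_real p, z) =
    (1 - of_real p + of_real p * weight p z (Suc n), 1 - of_real p + of_real p * weight p z n)"
proof (induction n)
  case 0
  then show ?case using assms by (simp add: power2_eq_square field_simps)
next
  case (Suc n)
  \<comment> \<open>In the new coordinates the first component of \<open>g\<close> is the product of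
    two consecutive weights, which is \<open>1 - p\<close> plus \<open>p\<close> times the next
    weight.\<close>
  then show ?case using assms by (simp add: g_def power2_eq_square)
qed

lemma weight_bounded:
  assumes "z \<in> E p" "0 < p"
  obtains K where "1 \<le> K" "\<And>n. cmod (weight p z n) \<le> K"
proof -
  from assms(1) obtain B where
    B: "\<And>n. norm ((g p ^^ n) (1 - of_real p + (1 - z - of_real p)\<^sup>2 / of_real p, z)) \<le> B"
    unfolding E_def filled_julia_def bounded_iff by auto
  have le: "cmod (weight p z n) \<le> (B + cmod (1 - of_real p)) / p" for n
  proof -
    let ?y = "1 - of_real p + of_real p * weight p z n"
    have "cmod ?y \<le> B"
      using B[of n] norm_snd_le[of ?y "1 - of_real p + of_real p * weight p z (Suc n)"] assms(2)
      by (simp add: g_iterate_weight)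
    moreover have "cmod (of_real p * weight p z n) \<le> cmod ?y + cmod (1 - of_real p)"
      using norm_triangle_ineq4[of ?y "1 - of_real p"] by simp
    ultimately show ?thesis using assms(2) by (simp add: norm_mult field_simps)
  qed
  show thesis
  proof (rule that)
    show "1 \<le> max 1 ((B + cmod (1 - of_real p)) / p)" by simp
    show "cmod (weight p z n) \<le> max 1 ((B + cmod (1 - of_real p)) / p)" for n
      using le[of n] by simp
  qed
qed

text \<open>This packages what the norm estimates use: a residual living on the range of
  \<open>h\<close>, with decay in \<open>j\<close> for the series in the \<open>ell\<close> norms
  and decay in \<open>n\<close> for the limit.\<close>

lemma approximate_eigenvectors:
  assumes "0 < p" "p < 1" "z \<in> E p"
  obtains u :: "nat \<Rightarrow> nat \<Rightarrow> complex" and h :: "nat \<Rightarrow> nat" and K t :: real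
  where "\<And>n. u n 0 = 1" "\<And>n. finite {N. u n N \<noteq> 0}" "strict_mono h" "0 \<le> K" "0 < t" "t < 1"
    "\<And>n N. N \<notin> range h \<Longrightarrow> S p (u n) N - z * u n N = 0"
    "\<And>n j. cmod (S p (u n) (h j) - z * u n (h j)) \<le> K * t ^ n * t ^ j"
proof -
  obtain K where K: "1 \<le> K" "\<And>n. cmod (weight p z n) \<le> K"
    using weight_bounded[OF assms(3,1)] by blast
  define t where "t = root 4 p"
  have t: "0 < t" "t < 1" "p = t ^ 4" using assms by (auto simp: t_def)
  \<comment> \<open>Cutting at \<open>Suc n\<close> meets the positivity condition of
    \<open>S_zprod_cut\<close>; the extra factor \<open>t\<close> goes into the constant.\<close>
  let ?u = "\<lambda>n. zprod (cut (Suc n) (weight p z))"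
  note bounds = S_zprod_cut[OF assms(1,2) zero_less_Suc K(1) K(2) t]
  show thesis
  proof (rule that[of ?u "\<lambda>j. F j - 1" "K / t\<^sup>2 * t" t])
    fix n
    show "?u n 0 = 1" by (rule zprod_0)
    have "{N. ?u n N \<noteq> 0} \<subseteq> {..<F (Suc n)}"
      using zprod_cut_eq_0[of "Suc n"] by (auto simp: not_le[symmetric])
    then show "finite {N. ?u n N \<noteq> 0}" using finite_subset by blast
    show "S p (?u n) N - z * ?u n N = 0" if "N \<notin> range (\<lambda>j. F j - 1)" for N
      using bounds(1)[OF that] .
    show "cmod (S p (?u n) (F j - 1) - z * ?u n (F j - 1)) \<le> K / t\<^sup>2 * t * t ^ n * t ^ j" for j
      using bounds(2)[of n j] by (simp add: mult.assoc)
  qed (use t K strict_mono_F_minus_1 in auto)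
qed

section \<open>Norms of approximate eigenvectors\<close>

text \<open>A bounded inverse would give \<open>1 \<le> nrm (u n) \<le> C * nrm (T (u n))\<close>,
  whose right side tends to 0.\<close>

lemma not_isomorphism_onI:
  assumes u: "\<And>n. u n \<in> X" "\<And>n. 1 \<le> nrm (u n)" and lim: "(\<lambda>n. nrm (T (u n))) \<longlonglongrightarrow> 0"
  shows "\<not> isomorphism_on X nrm T"
proof
  assume iso: "isomorphism_on X nrm T"
  then have bij: "bij_betw T X X" and "bounded_operator_on X nrm (inv_into X T)"
    unfolding isomorphism_on_def by blast+
  then have "\<exists>C. \<forall>v\<in>X. nrm (inv_into X T v) \<le> C * nrm v"
    unfolding bounded_operator_on_def by (elim conjE)
  then obtain C where C: "\<forall>v\<in>X. nrm (inv_into X T v) \<le> C * nrm v" ..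
  have "1 \<le> C * nrm (T (u n))" for n
  proof -
    have "T (u n) \<in> X" by (rule bij_betwE[OF bij, rule_format, OF u(1)])
    with C have "nrm (inv_into X T (T (u n))) \<le> C * nrm (T (u n))" by (rule bspec)
    also have "inv_into X T (T (u n)) = u n"
      by (rule inv_into_f_f[OF bij_betw_imp_inj_on[OF bij] u(1)])
    finally show ?thesis using u(2)[of n] by (rule order_trans[rotated])
  qed
  then have "1 \<le> (0::real)"
    by (intro LIMSEQ_le_const[OF tendsto_mult_right_zero[OF lim, of C]]) simp
  then show False by simp
qed

section \<open>Estimates in the sup norm and the \<open>ell\<close> norms\<close>

lemma norm_le_sup_norm:
  assumes "bounded (range v)"
  shows "cmod (v n) \<le> sup_norm v"
proof -
  have "bdd_above (range (\<lambda>n. cmod (v n)))"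
    using assms by (intro bounded_imp_bdd_above) (simp only: bounded_norm_comp)
  then show ?thesis unfolding sup_norm_def by (rule cSUP_upper[OF UNIV_I])
qed

lemma sup_norm_le: "(\<And>n. cmod (v n) \<le> B) \<Longrightarrow> sup_norm v \<le> B"
  unfolding sup_norm_def by (rule cSUP_least) simp_all

lemma norm_le_ell_norm:
  assumes "v \<in> ell \<alpha>" "1 \<le> \<alpha>"
  shows "cmod (v n) \<le> ell_norm \<alpha> v"
proof -
  have "cmod (v n) powr \<alpha> \<le> (\<Sum>n. cmod (v n) powr \<alpha>)"
    using assms(1) sum_le_suminf[of "\<lambda>n. cmod (v n) powr \<alpha>" "{n}"] by (simp add: ell_def)
  then have "(cmod (v n) powr \<alpha>) powr (1 / \<alpha>) \<le> ell_norm \<alpha> v"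
    unfolding ell_norm_def using assms(2) by (intro powr_mono2) simp_all
  moreover have "(cmod (v n) powr \<alpha>) powr (1 / \<alpha>) = cmod (v n)"
    using assms(2) by (simp add: powr_powr)
  ultimately show ?thesis by simp
qed

text \<open>Reindexing the series along \<open>h\<close> allows comparison with a geometric series
  of ratio \<open>t powr \<alpha>\<close>. The bound is linear in \<open>D\<close>, so a factor
  \<open>t ^ n\<close> inside \<open>D\<close> survives.\<close>

lemma ell_norm_le_geometric:
  assumes "1 \<le> \<alpha>" "strict_mono h" "0 \<le> D" "0 < t" "t < 1"
    and "\<And>N. N \<notin> range h \<Longrightarrow> v N = 0" "\<And>j. cmod (v (h j)) \<le> D * t ^ j"
  shows "ell_norm \<alpha> v \<le> D * (1 / (1 - t powr \<alpha>)) powr (1 / \<alpha>)"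
proof -
  have r: "0 < t powr \<alpha>" "t powr \<alpha> < 1"
    using assms(1,4,5) powr_less_mono2[of \<alpha> t 1] by auto
  have le: "cmod (v (h j)) powr \<alpha> \<le> D powr \<alpha> * (t powr \<alpha>) ^ j" for j
  proof -
    have "cmod (v (h j)) powr \<alpha> \<le> (D * t ^ j) powr \<alpha>"
      using assms(1,7) by (intro powr_mono2) auto
    also have "\<dots> = D powr \<alpha> * (t powr \<alpha>) ^ j"
    proof -
      have "(t ^ j) powr \<alpha> = (t powr \<alpha>) ^ j"
        using assms(4) by (simp only: powr_realpow[symmetric] powr_powr r(1) mult.commute)
      then show ?thesis using assms(3,4) by (subst powr_mult) auto
    qed
    finally show ?thesis .
  qed
  have geo: "(\<lambda>j. D powr \<alpha> * (t powr \<alpha>) ^ j) sums (D powr \<alpha> * (1 / (1 - t powr \<alpha>)))"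
    using r by (intro sums_mult geometric_sums) auto
  have "summable (\<lambda>j. cmod (v (h j)) powr \<alpha>)"
    by (rule summable_comparison_test'[OF sums_summable[OF geo], of 0]) (use le in auto)
  then have "(\<Sum>j. cmod (v (h j)) powr \<alpha>) \<le> (\<Sum>j. D powr \<alpha> * (t powr \<alpha>) ^ j)"
    by (intro suminf_le le sums_summable[OF geo])
  moreover have "(\<Sum>j. cmod (v (h j)) powr \<alpha>) = (\<Sum>N. cmod (v N) powr \<alpha>)"
    using assms(6) by (intro suminf_mono_reindex[OF assms(2)]) auto
  moreover have "0 \<le> (\<Sum>j. cmod (v (h j)) powr \<alpha>)"
    by (intro suminf_nonneg) (use \<open>summable _\<close> in auto)
  ultimately have "ell_norm \<alpha> v \<le> (D powr \<alpha> * (1 / (1 - t powr \<alpha>))) powr (1 / \<alpha>)"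
    unfolding ell_norm_def using assms(1) sums_unique[OF geo] by (intro powr_mono2) auto
  also have "\<dots> = D * (1 / (1 - t powr \<alpha>)) powr (1 / \<alpha>)"
  proof -
    have "\<alpha> * (1 / \<alpha>) = 1" using assms(1) by simp
    then have "(D powr \<alpha>) powr (1 / \<alpha>) = D"
      using assms(3) by (simp only: powr_powr powr_one)
    then show ?thesis using r by (subst powr_mult) auto
  qed
  finally show ?thesis .
qed

lemma tendsto_0_power_bound:
  fixes t :: real
  assumes "0 < t" "t < 1" "\<And>n. 0 \<le> f n" "\<And>n. f n \<le> K * t ^ n"
  shows "f \<longlonglongrightarrow> 0"
proof (rule tendsto_sandwich[of "\<lambda>_. 0" f sequentially "\<lambda>n. K * t ^ n"])
  show "(\<lambda>n. K * t ^ n) \<longlonglongrightarrow> 0"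
    using assms(1,2) by (intro tendsto_mult_right_zero LIMSEQ_power_zero) auto
qed (use assms in auto)

lemma finite_support_tendsto_0:
  fixes v :: "nat \<Rightarrow> complex"
  assumes "finite {n. v n \<noteq> 0}"
  shows "v \<longlonglongrightarrow> 0"
proof -
  obtain k where "{n. v n \<noteq> 0} \<subseteq> {..<k}" using finite_nat_bounded[OF assms] by blast
  then have "v n = 0" if "k \<le> n" for n using that by force
  then show ?thesis by (rule tendsto_eventually[OF eventually_sequentiallyI])
qed

text \<open>Stated for any \<open>X\<close> containing the finitely supported sequences, so that
  \<open>ell_infty\<close>, \<open>c_zero\<close> and \<open>c_conv\<close> are treated at
  once.\<close>

lemma E_subset_spectrum_sup_norm:
  assumes "0 < p" "p < 1" and X: "\<And>v. finite {n. v n \<noteq> 0} \<Longrightarrow> v \<in> X"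
  shows "E p \<subseteq> spectrum_on X sup_norm (S p)"
proof
  fix z assume z: "z \<in> E p"
  show "z \<in> spectrum_on X sup_norm (S p)"
  proof (rule approximate_eigenvectors[OF assms(1,2) z])
    fix u :: "nat \<Rightarrow> nat \<Rightarrow> complex" and h :: "nat \<Rightarrow> nat" and K t :: real
    assume
      u: "\<And>n. u n 0 = 1" "\<And>n. finite {N. u n N \<noteq> 0}" and t: "strict_mono h" "0 \<le> K" "0 < t" "t < 1"
      and T: "\<And>n N. N \<notin> range h \<Longrightarrow> S p (u n) N - z * u n N = 0"
        "\<And>n j. cmod (S p (u n) (h j) - z * u n (h j)) \<le> K * t ^ n * t ^ j"
    let ?T = "\<lambda>v n. S p v n - z * v n"
    have le: "cmod (?T (u n) N) \<le> K * t ^ n" for n N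
    proof (cases "N \<in> range h")
      case True
      then obtain j where "N = h j" by blast
      moreover have "K * t ^ n * t ^ j \<le> K * t ^ n * 1"
        using t by (intro mult_left_mono) (auto simp: power_le_one)
      ultimately show ?thesis using T(2)[of n j] by simp
    next
      case False
      with t show ?thesis by (simp add: T(1))
    qed
    \<comment> \<open>Boundedness ensures that the supremum in \<open>sup_norm\<close> dominates the
      entries, hence is nonnegative.\<close>
    have bdd: "bounded (range (?T (u n)))" for n
      by (rule boundedI[of _ "K * t ^ n"]) (use le in blast)
    have "\<not> isomorphism_on X sup_norm ?T"
    proof (rule not_isomorphism_onI)
      show "u n \<in> X" for n by (intro X u)
      have "bounded (range (u n))" for n
        by (intro convergent_imp_bounded[OF finite_support_tendsto_0] u)
      then show "1 \<le> sup_norm (u n)" for n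
        using norm_le_sup_norm[of "u n" 0] u(1)[of n] by simp
      show "(\<lambda>n. sup_norm (?T (u n))) \<longlonglongrightarrow> 0"
      proof (rule tendsto_0_power_bound[OF t(3,4)])
        show "0 \<le> sup_norm (?T (u n))" for n
          by (rule order_trans[OF norm_ge_zero norm_le_sup_norm[OF bdd]])
        show "sup_norm (?T (u n)) \<le> K * t ^ n" for n
          using le by (rule sup_norm_le)
      qed
    qed
    then show "z \<in> spectrum_on X sup_norm (S p)" by (simp add: spectrum_on_def)
  qed
qed

lemma E_subset_spectrum_ell:
  assumes "0 < p" "p < 1" "1 \<le> \<alpha>"
  shows "E p \<subseteq> spectrum_on (ell \<alpha>) (ell_norm \<alpha>) (S p)"
proof
  fix z assume z: "z \<in> E p"
  show "z \<in> spectrum_on (ell \<alpha>) (ell_norm \<alpha>) (S p)"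
  proof (rule approximate_eigenvectors[OF assms(1,2) z])
    fix u :: "nat \<Rightarrow> nat \<Rightarrow> complex" and h :: "nat \<Rightarrow> nat" and K t :: real
    assume
      u: "\<And>n. u n 0 = 1" "\<And>n. finite {N. u n N \<noteq> 0}" and t: "strict_mono h" "0 \<le> K" "0 < t" "t < 1"
      and T: "\<And>n N. N \<notin> range h \<Longrightarrow> S p (u n) N - z * u n N = 0"
        "\<And>n j. cmod (S p (u n) (h j) - z * u n (h j)) \<le> K * t ^ n * t ^ j"
    let ?T = "\<lambda>v n. S p v n - z * v n"
    have ell: "u n \<in> ell \<alpha>" for n
      unfolding ell_def mem_Collect_eq by (rule summable_finite[OF u(2)[of n]]) simp
    have "\<not> isomorphism_on (ell \<alpha>) (ell_norm \<alpha>) ?T"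
    proof (rule not_isomorphism_onI[OF ell])
      show "1 \<le> ell_norm \<alpha> (u n)" for n
        using norm_le_ell_norm[OF ell assms(3), of n 0] u(1)[of n] by simp
      let ?c = "(1 / (1 - t powr \<alpha>)) powr (1 / \<alpha>)"
      show "(\<lambda>n. ell_norm \<alpha> (?T (u n))) \<longlonglongrightarrow> 0"
      proof (rule tendsto_0_power_bound[OF t(3,4)])
        show "0 \<le> ell_norm \<alpha> (?T (u n))" for n by (simp add: ell_norm_def)
        have "ell_norm \<alpha> (?T (u n)) \<le> K * t ^ n * ?c" for n
        proof (rule ell_norm_le_geometric[OF assms(3) t(1) _ t(3,4) T])
          show "0 \<le> K * t ^ n" using t by simp
        qed
        then show "ell_norm \<alpha> (?T (u n)) \<le> K * ?c * t ^ n" for n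
          by (simp add: mult_ac)
      qed
    qed
    then show "z \<in> spectrum_on (ell \<alpha>) (ell_norm \<alpha>) (S p)" by (simp add: spectrum_on_def)
  qed
qed

theorem theorem3:
  fixes p :: real
  assumes "0 < p" and "p < 1"
  shows "E p \<subseteq> spectrum_on ell_infty sup_norm (S p) \<and>
         E p \<subseteq> spectrum_on c_zero sup_norm (S p) \<and>
         E p \<subseteq> spectrum_on c_conv sup_norm (S p) \<and>
         (\<forall>\<alpha>\<ge>1. E p \<subseteq> spectrum_on (ell \<alpha>) (ell_norm \<alpha>) (S p))"
proof (intro conjI allI impI)
  show "E p \<subseteq> spectrum_on ell_infty sup_norm (S p)"
  proof (rule E_subset_spectrum_sup_norm[OF assms])
    fix v :: "nat \<Rightarrow> complex" assume "finite {n. v n \<noteq> 0}"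
    then show "v \<in> ell_infty"
      unfolding ell_infty_def mem_Collect_eq
      by (intro convergent_imp_bounded[OF finite_support_tendsto_0])
  qed
  show "E p \<subseteq> spectrum_on c_zero sup_norm (S p)"
    by (rule E_subset_spectrum_sup_norm[OF assms]) (simp add: c_zero_def finite_support_tendsto_0)
  show "E p \<subseteq> spectrum_on c_conv sup_norm (S p)"
  proof (rule E_subset_spectrum_sup_norm[OF assms])
    fix v :: "nat \<Rightarrow> complex" assume "finite {n. v n \<noteq> 0}"
    then show "v \<in> c_conv"
      unfolding c_conv_def mem_Collect_eq by (intro convergentI[OF finite_support_tendsto_0])
  qed
  show "E p \<subseteq> spectrum_on (ell \<alpha>) (ell_norm \<alpha>) (S p)" if "1 \<le> \<alpha>" for \<alpha>
    by (rule E_subset_spectrum_ell[OF assms that])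
qed

end
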